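(* Let $(\mathfrak{g},[\cdot,\cdot])$ be a Leibniz algebra, $(V,\rho^L,\rho^R)$ a representation of it, and $H:\mathfrak{g}\otimes\mathfrak{g}\to V$ a $2$-cocycle of $\mathfrak{g}$ with coefficients in $V$. Let $K:V\to\mathfrak{g}$ be an $H$-twisted relative Rota-Baxter operator. Then there is an NS-Leibniz algebra structure on $V$ with bilinear operations given by $$u\triangleright v:=\rho^R(Kv)u,\qquad u\triangleleft v:=\rho^L(Ku)v,\qquad u\diamond v:=H(Ku,Kv),\qquad u,v\in V.$$
   Context: All vector spaces are finite-dimensional over $\mathbb{C}$. A Leibniz algebra is a vector space $\mathfrak{g}$ with a bilinear bracket satisfying $[x,[y,z]]=[[x,y],z]+[y,[x,z]]$ for all $x,y,z\in\mathfrak{g}$. A representation of $\mathfrak{g}$ is a triple $(V,\rho^L,\rho^R)$ with $V$ a vector space and linear maps $\rho^L,\rho^R:\mathfrak{g}\to gl(V)$ such that for all $x,y\in\mathfrak{g}$: $\rho^L([x,y])=\rho^L(x)\rho^L(y)-\rho^L(y)\rho^L(x)$, $\rho^R([x,y])=\rho^L(x)\rho^R(y)-\rho^R(y)\rho^L(x)$, and $\rho^R([x,y])=\rho^L(x)\rho^R(y)+\rho^R(y)\rho^R(x)$. A $2$-cocycle of $\mathfrak{g}$ with coefficients in $V$ is a bilinear map $H:\mathfrak{g}\otimes\mathfrak{g}\to V$ with $\rho^L(x)H(y,z)-\rho^L(y)H(x,z)-\rho^R(z)H(x,y)-H([x,y],z)-H(y,[x,z])+H(x,[y,z])=0$ for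 all $x,y,z\in\mathfrak{g}$. A linear map $K:V\to\mathfrak{g}$ is an $H$-twisted relative Rota-Baxter operator if $[Ku,Kv]=K(\rho^L(Ku)v+\rho^R(Kv)u+H(Ku,Kv))$ for all $u,v\in V$. An NS-Leibniz algebra is a vector space $A$ with three bilinear operations $\triangleright,\triangleleft,\diamond:A\otimes A\to A$ such that, with $x\ast y=x\triangleright y+x\triangleleft y+x\diamond y$, for all $x,y,z\in A$: (A1) $x\triangleright(y\ast z)=(x\triangleright y)\triangleright z+y\triangleleft(x\triangleright z)$; (A2) $x\triangleleft(y\triangleright z)=(x\triangleleft y)\triangleright z+y\triangleright(x\ast z)$; (A3) $x\triangleleft(y\triangleleft z)=(x\ast y)\triangleleft z+y\triangleleft(x\triangleleft z)$; (A4) $x\triangleleft(y\diamond z)+x\diamond(y\ast z)=(x\diamond y)\triangleright z+(x\ast y)\diamond z+y\triangleleft(x\diamond z)+y\diamond(x\ast z)$. *)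

theory Defs
  imports Complex_Main
begin

locale complex_fin_dim_space = vector_space scale
  for scale :: "complex \<Rightarrow> 'a::ab_group_add \<Rightarrow> 'a" +
  assumes fin_dim: "\<exists>B. finite_dimensional_vector_space scale B"

definition bilinear_map ::
  "(complex \<Rightarrow> 'a::ab_group_add \<Rightarrow> 'a) \<Rightarrow> (complex \<Rightarrow> 'b::ab_group_add \<Rightarrow> 'b) \<Rightarrow>
   (complex \<Rightarrow> 'c::ab_group_add \<Rightarrow> 'c) \<Rightarrow> ('a \<Rightarrow> 'b \<Rightarrow> 'c) \<Rightarrow> bool" where
  "bilinear_map s1 s2 s3 f \<longleftrightarrow>
     (\<forall>x. Vector_Spaces.linear s2 s3 (\<lambda>y. f x y)) \<and>
     (\<forall>y. Vector_Spaces.linear s1 s3 (\<lambda>x. f x y))"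

locale leibniz_algebra = complex_fin_dim_space scale
  for scale :: "complex \<Rightarrow> 'g::ab_group_add \<Rightarrow> 'g" +
  fixes br :: "'g \<Rightarrow> 'g \<Rightarrow> 'g"
  assumes br_bilinear: "bilinear_map scale scale scale br"
    and leibniz: "br x (br y z) = br (br x y) z + br y (br x z)"

(* A linear map g -> gl(V) is curried to a function g => V => V: bilinearity says
   that each rho x is an endomorphism of V and that x |-> rho x is linear. *)
locale leibniz_representation =
  leibniz_algebra scaleG br + V: complex_fin_dim_space scaleV
  for scaleG :: "complex \<Rightarrow> 'g::ab_group_add \<Rightarrow> 'g"
    and br :: "'g \<Rightarrow> 'g \<Rightarrow> 'g"
    and scaleV :: "complex \<Rightarrow> 'v::ab_group_add \<Rightarrow> 'v" +
  fixes rhoL rhoR :: "'g \<Rightarrow> 'v \<Rightarrow> 'v"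
  assumes rhoL_linear: "bilinear_map scaleG scaleV scaleV rhoL"
    and rhoR_linear: "bilinear_map scaleG scaleV scaleV rhoR"
    and rhoL_br: "rhoL (br x y) v = rhoL x (rhoL y v) - rhoL y (rhoL x v)"
    and rhoR_br: "rhoR (br x y) v = rhoL x (rhoR y v) - rhoR y (rhoL x v)"
    and rhoR_br': "rhoR (br x y) v = rhoL x (rhoR y v) + rhoR y (rhoR x v)"

locale leibniz_2_cocycle = leibniz_representation scaleG br scaleV rhoL rhoR
  for scaleG :: "complex \<Rightarrow> 'g::ab_group_add \<Rightarrow> 'g"
    and br :: "'g \<Rightarrow> 'g \<Rightarrow> 'g"
    and scaleV :: "complex \<Rightarrow> 'v::ab_group_add \<Rightarrow> 'v"
    and rhoL rhoR :: "'g \<Rightarrow> 'v \<Rightarrow> 'v" +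
  fixes H :: "'g \<Rightarrow> 'g \<Rightarrow> 'v"
  assumes H_bilinear: "bilinear_map scaleG scaleG scaleV H"
    and cocycle:
      "rhoL x (H y z) - rhoL y (H x z) - rhoR z (H x y)
         - H (br x y) z - H y (br x z) + H x (br y z) = 0"

locale twisted_rota_baxter = leibniz_2_cocycle scaleG br scaleV rhoL rhoR H
  for scaleG :: "complex \<Rightarrow> 'g::ab_group_add \<Rightarrow> 'g"
    and br :: "'g \<Rightarrow> 'g \<Rightarrow> 'g"
    and scaleV :: "complex \<Rightarrow> 'v::ab_group_add \<Rightarrow> 'v"
    and rhoL rhoR :: "'g \<Rightarrow> 'v \<Rightarrow> 'v"
    and H :: "'g \<Rightarrow> 'g \<Rightarrow> 'v" +
  fixes K :: "'v \<Rightarrow> 'g"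
  assumes K_linear: "Vector_Spaces.linear scaleV scaleG K"
    and rota_baxter:
      "br (K u) (K v) = K (rhoL (K u) v + rhoR (K v) u + H (K u) (K v))"

locale ns_leibniz_algebra = complex_fin_dim_space scale
  for scale :: "complex \<Rightarrow> 'a::ab_group_add \<Rightarrow> 'a" +
  fixes right :: "'a \<Rightarrow> 'a \<Rightarrow> 'a" (infixl "\<triangleright>" 70)
    and left :: "'a \<Rightarrow> 'a \<Rightarrow> 'a" (infixl "\<triangleleft>" 70)
    and diam :: "'a \<Rightarrow> 'a \<Rightarrow> 'a" (infixl "\<diamondop>" 70)
    and star :: "'a \<Rightarrow> 'a \<Rightarrow> 'a" (infixl "\<star>" 70)
  defines "x \<star> y \<equiv> x \<triangleright> y + x \<triangleleft> y + x \<diamondop> y"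
  assumes right_bilinear: "bilinear_map scale scale scale (\<triangleright>)"
    and left_bilinear: "bilinear_map scale scale scale (\<triangleleft>)"
    and diam_bilinear: "bilinear_map scale scale scale (\<diamondop>)"
    and A1: "x \<triangleright> (y \<star> z) = (x \<triangleright> y) \<triangleright> z + y \<triangleleft> (x \<triangleright> z)"
    and A2: "x \<triangleleft> (y \<triangleright> z) = (x \<triangleleft> y) \<triangleright> z + y \<triangleright> (x \<star> z)"
    and A3: "x \<triangleleft> (y \<triangleleft> z) = (x \<star> y) \<triangleleft> z + y \<triangleleft> (x \<triangleleft> z)"
    and A4: "x \<triangleleft> (y \<diamondop> z) + x \<diamondop> (y \<star> z)
             = (x \<diamondop> y) \<triangleright> z + (x \<star> y) \<diamondop> z + y \<triangleleft> (x \<diamondop> z) + y \<diamondop> (x \<star> z)"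

end

theory Submission
  imports Defs
begin

text \<open>The Rota-Baxter identity says that \<open>K\<close> carries the sum of the three
  operations to the bracket of the Leibniz algebra. Once \<open>K\<close> of each such sum is
  replaced by a bracket, the axioms become known identities at \<open>K x\<close>,
  \<open>K y\<close>, \<open>K z\<close>: A1, A2, A3 are \<open>rhoR_br'\<close>,
  \<open>rhoR_br\<close>, \<open>rhoL_br\<close>, and A4 is the cocycle condition with its negative
  terms moved across. Bilinearity is inherited by precomposing with the linear map
  \<open>K\<close>.\<close>

lemma bilinear_map_compose_left:
  assumes "bilinear_map s2 s3 s4 f" and "Vector_Spaces.linear s1 s2 g"
  shows "bilinear_map s1 s3 s4 (\<lambda>x y. f (g x) y)"
  using assms Vector_Spaces.linear_compose[of s1 s2 g s4]
  unfolding bilinear_map_def comp_def by blast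

lemma bilinear_map_flip:
  "bilinear_map s1 s2 s3 f \<Longrightarrow> bilinear_map s2 s1 s3 (\<lambda>x y. f y x)"
  unfolding bilinear_map_def by blast

theorem proposition5p5:
  fixes scaleG :: "complex \<Rightarrow> 'g::ab_group_add \<Rightarrow> 'g"
    and br :: "'g \<Rightarrow> 'g \<Rightarrow> 'g"
    and scaleV :: "complex \<Rightarrow> 'v::ab_group_add \<Rightarrow> 'v"
    and rhoL rhoR :: "'g \<Rightarrow> 'v \<Rightarrow> 'v"
    and H :: "'g \<Rightarrow> 'g \<Rightarrow> 'v"
    and K :: "'v \<Rightarrow> 'g"
  assumes "leibniz_algebra scaleG br"
    and "leibniz_representation scaleG br scaleV rhoL rhoR"
    and "leibniz_2_cocycle scaleG br scaleV rhoL rhoR H"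
    and "twisted_rota_baxter scaleG br scaleV rhoL rhoR H K"
  shows "ns_leibniz_algebra scaleV
           (\<lambda>u v. rhoR (K v) u) (\<lambda>u v. rhoL (K u) v) (\<lambda>u v. H (K u) (K v))"
proof -
  interpret twisted_rota_baxter scaleG br scaleV rhoL rhoR H K
    by (fact assms(4))
  \<comment> \<open>The summands follow the order in \<open>star\<close>, unlike in
    \<open>rota_baxter\<close>, so this serves as a rewrite rule on the axioms.\<close>
  have K_star: "K (rhoR (K v) u + rhoL (K u) v + H (K u) (K v)) = br (K u) (K v)" for u v
    by (simp add: rota_baxter add.commute)
  show ?thesis
  proof (unfold_locales, goal_cases)
    case 1
    show ?case
      \<comment> \<open>The flip is due to \<open>rhoR\<close> acting through the second
        factor.\<close>
      using bilinear_map_flip[OF bilinear_map_compose_left[OF rhoR_linear K_linear]] .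
  next
    case 2
    show ?case
      using bilinear_map_compose_left[OF rhoL_linear K_linear] .
  next
    case 3
    have "bilinear_map scaleV scaleG scaleV (\<lambda>u y. H (K u) y)"
      using bilinear_map_compose_left[OF H_bilinear K_linear] .
    \<comment> \<open>Flipping before and after turns composition on the left into composition in
      the second argument.\<close>
    from bilinear_map_flip[OF bilinear_map_compose_left[OF bilinear_map_flip[OF this] K_linear]]
    show ?case .
  next
    case (4 x y z)
    show ?case
      by (simp add: K_star rhoR_br')
  next
    case (5 x y z)
    show ?case
      by (simp add: K_star rhoR_br)
  next
    case (6 x y z)
    show ?case
      by (simp add: K_star rhoL_br)
  next
    case (7 x y z)
    show ?case
      using cocycle[of "K x" "K y" "K z"] unfolding K_star by (simp add: algebra_simps)
  qed
qed

end
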